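(* Let $d\in\mathbb{N}$, let $U\subset\mathbb{R}^d$ with $\operatorname{diam}U=\infty$, let $V\subset\mathbb{R}^d$ be a Delone set, and let $f:U\to V$ be a bijection. Then the following are equivalent: (i) $f$ is co-uniformly continuous; (ii) $f$ is co-uniformly continuous of order $O(r)$; (iii) $f^{-1}$ is Lipschitz.
   Context: $\mathbb{N}=\{1,2,\dots\}$, $B(x,r)$ is the open Euclidean ball of radius $r$ centred at $x$. A set $V\subset\mathbb{R}^d$ is a Delone set if there is $s>0$ such that every closed ball of radius $s$ in $\mathbb{R}^d$ contains at most one point of $V$, and there is $S>0$ such that every closed ball of radius $S$ in $\mathbb{R}^d$ contains at least one point of $V$. Given a strictly increasing function $\omega:(0,\infty)\to(0,\infty)$, a bijection $f:U\to V$ is $\omega$-co-uniformly continuous if $f^{-1}(B(f(x),r))\subseteq B(x,\omega(r))$ for every $x\in U$ and $r>0$. It is co-uniformly continuous if it is $\omega$-co-uniformly continuous for some strictly increasing $\omega:(0,\infty)\to(0,\infty)$, and co-uniformly continuous of order $O(r)$ if such an $\omega$ can be chosen with $\omega(r)\in O(r)$, i.e. there is a constant $C>0$ with $\omega(r)\le Cr$ for all $r>0$. *)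

theory Defs
  imports "HOL-Analysis.Analysis"
begin

text \<open>The library's \<open>diameter\<close> is real-valued and equals \<open>0\<close> on unbounded sets, so an
  extended-valued version is needed to say that a set has infinite diameter.\<close>

definition ediameter :: "'a::metric_space set \<Rightarrow> ennreal" where
  "ediameter U = (SUP x\<in>U. SUP y\<in>U. ennreal (dist x y))"

lemma ediameter_eq_top_iff: "ediameter U = \<infinity> \<longleftrightarrow> \<not> bounded U"
proof
  assume top: "ediameter U = \<infinity>"
  show "\<not> bounded U"
  proof
    assume "bounded U"
    then obtain e where e: "\<And>x y. x \<in> U \<Longrightarrow> y \<in> U \<Longrightarrow> dist x y \<le> e"
      unfolding bounded_two_points by auto
    have "ediameter U \<le> ennreal e"
      unfolding ediameter_def by (intro SUP_least ennreal_leI e)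
    with top show False
      by (simp add: top_unique)
  qed
next
  assume unbounded: "\<not> bounded U"
  show "ediameter U = \<infinity>"
  proof (rule ccontr)
    assume "ediameter U \<noteq> \<infinity>"
    then obtain e where e: "ediameter U = ennreal e" "e \<ge> 0"
      by (cases "ediameter U") auto
    have "dist x y \<le> e" if "x \<in> U" "y \<in> U" for x y
    proof -
      have "ennreal (dist x y) \<le> ediameter U"
        unfolding ediameter_def by (rule SUP_upper2[OF that(1)], rule SUP_upper[OF that(2)])
      with e show ?thesis by simp
    qed
    then have "bounded U"
      unfolding bounded_two_points by auto
    with unbounded show False by contradiction
  qed
qed

definition delone :: "'a::metric_space set \<Rightarrow> bool" where
  "delone V \<longleftrightarrow>
     (\<exists>s>0. \<forall>c. \<forall>u\<in>V \<inter> cball c s. \<forall>v\<in>V \<inter> cball c s. u = v) \<and>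
     (\<exists>S>0. \<forall>c. V \<inter> cball c S \<noteq> {})"

text \<open>A modulus is a strictly increasing function from \<open>(0,\<infinity>)\<close> to \<open>(0,\<infinity>)\<close>; the values of
  the HOL function outside \<open>(0,\<infinity>)\<close> are irrelevant.\<close>

definition modulus :: "(real \<Rightarrow> real) \<Rightarrow> bool" where
  "modulus \<omega> \<longleftrightarrow> \<omega> \<in> {0<..} \<rightarrow> {0<..} \<and> strict_mono_on {0<..} \<omega>"

text \<open>In the following definitions \<open>f\<close> is meant to be a bijection from \<open>U\<close> onto some set \<open>V\<close>;
  preimages are therefore taken within \<open>U\<close>.\<close>

definition co_uniformly_continuous_wrt ::
    "(real \<Rightarrow> real) \<Rightarrow> 'a::metric_space set \<Rightarrow> ('a \<Rightarrow> 'b::metric_space) \<Rightarrow> bool" where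
  "co_uniformly_continuous_wrt \<omega> U f \<longleftrightarrow>
     (\<forall>x\<in>U. \<forall>r>0. f -` ball (f x) r \<inter> U \<subseteq> ball x (\<omega> r))"

definition co_uniformly_continuous ::
    "'a::metric_space set \<Rightarrow> ('a \<Rightarrow> 'b::metric_space) \<Rightarrow> bool" where
  "co_uniformly_continuous U f \<longleftrightarrow>
     (\<exists>\<omega>. modulus \<omega> \<and> co_uniformly_continuous_wrt \<omega> U f)"

text \<open>The bound \<open>\<omega> r \<le> C * r\<close> is required for all \<open>r > 0\<close>, not only asymptotically.\<close>

definition co_uniformly_continuous_linear ::
    "'a::metric_space set \<Rightarrow> ('a \<Rightarrow> 'b::metric_space) \<Rightarrow> bool" where
  "co_uniformly_continuous_linear U f \<longleftrightarrow>
     (\<exists>\<omega>. modulus \<omega> \<and> co_uniformly_continuous_wrt \<omega> U f \<and> (\<exists>C>0. \<forall>r>0. \<omega> r \<le> C * r))"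

end

theory Submission
  imports Defs
begin

text \<open>The substantial implication is from co-uniform continuity to the Lipschitz property of
  \<open>f\<^sup>-\<^sup>1\<close>. Walk along the segment between two points of \<open>V\<close> in steps of bounded length and replace
  each intermediate point by a nearby point of \<open>V\<close>: the number of steps is linear in the distance,
  and \<open>f\<^sup>-\<^sup>1\<close> moves by a bounded amount at each step. As \<open>V\<close> is uniformly discrete, the additive
  error is absorbed into the linear bound.\<close>

lemma relatively_dense_chain_bound:
  fixes V :: "'a::real_normed_vector set" and g :: "'a \<Rightarrow> 'b::metric_space"
  assumes dense: "\<And>c. V \<inter> cball c S \<noteq> {}"
    and "S \<ge> 0" "s \<ge> 0"
    and step: "\<And>u v. u \<in> V \<Longrightarrow> v \<in> V \<Longrightarrow> dist u v \<le> 2 * S + s \<Longrightarrow> dist (g u) (g v) \<le> M"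
    and "u \<in> V" "v \<in> V" "dist u c \<le> S" "dist c v \<le> real n * s"
  shows "dist (g u) (g v) \<le> (real n + 1) * M"
  using assms(5-8)
\<comment> \<open>\<open>c\<close> is the current point on the segment towards \<open>v\<close>, and
  \<open>u\<close> is a point of \<open>V\<close> near it. Since each new point of \<open>V\<close>
  is chosen near the segment and not near its predecessor, the errors \<open>S\<close> do not
  accumulate.\<close>
proof (induction n arbitrary: u c)
  case 0
  \<comment> \<open>The walk has arrived, but \<open>u\<close> may still differ from
    \<open>v\<close>; this last jump is the extra 1 in \<open>real n + 1\<close>.\<close>
  then have "c = v" by simp
  with 0 assms(2,3) have "dist u v \<le> 2 * S + s" by simp
  with step 0 show ?case by simp
next
  case (Suc n)
  \<comment> \<open>One of \<open>n + 1\<close> equal parts of the remaining segment: its length is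
    at most \<open>s\<close>, and at most \<open>n * s\<close> remains after it.\<close>
  define t where "t = 1 / (real n + 1)"
  define c' where "c' = c + t *\<^sub>R (v - c)"
  have t: "0 \<le> t" "t * (real n + 1) = 1" "0 \<le> 1 - t" "(1 - t) * (real n + 1) = real n"
    by (auto simp: t_def field_simps)
  have cv: "dist c v \<le> (real n + 1) * s"
    using Suc.prems by (simp add: algebra_simps)
  have "dist c c' = t * dist c v"
    using t(1) by (simp add: c'_def dist_norm norm_minus_commute)
  also have "\<dots> \<le> t * ((real n + 1) * s)"
    using cv t(1) by (rule mult_left_mono)
  finally have cc': "dist c c' \<le> s"
    using t(2) by (simp flip: mult.assoc)
  have "c' - v = (1 - t) *\<^sub>R (c - v)"
    by (simp add: c'_def algebra_simps)
  then have "dist c' v = (1 - t) * dist c v"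
    using t(3) by (simp add: dist_norm)
  also have "\<dots> \<le> (1 - t) * ((real n + 1) * s)"
    using cv t(3) by (rule mult_left_mono)
  finally have c'v: "dist c' v \<le> real n * s"
    using t(4) by (simp flip: mult.assoc)
  obtain u' where u': "u' \<in> V" "dist u' c' \<le> S"
    using dense[of c'] by (auto simp: dist_commute)
  have "dist u u' \<le> dist u c + dist c c' + dist u' c'"
    by metric
  then have "dist u u' \<le> 2 * S + s"
    using cc' u'(2) Suc.prems(3) by linarith
  then have "dist (g u) (g u') \<le> M"
    using step Suc.prems(1) u'(1) by blast
  moreover have "dist (g u') (g v) \<le> (real n + 1) * M"
    by (rule Suc.IH[OF u'(1) Suc.prems(2) u'(2) c'v])
  ultimately have "dist (g u) (g v) \<le> M + (real n + 1) * M"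
    using dist_triangle[of "g u" "g v" "g u'"] by linarith
  then show ?case
    by (simp add: algebra_simps)
qed

text \<open>Boundedness at each scale suffices: the chain bound gives an affine estimate in
  \<open>dist u v\<close>, and distinct points of \<open>V\<close> are more than \<open>s\<close>
  apart, which makes it linear.\<close>

lemma delone_lipschitz_on:
  fixes V :: "'a::real_normed_vector set" and g :: "'a \<Rightarrow> 'b::metric_space"
  assumes "delone V"
    and bounded_steps: "\<And>r. r > 0 \<Longrightarrow> \<exists>M. \<forall>u\<in>V. \<forall>v\<in>V. dist u v < r \<longrightarrow> dist (g u) (g v) \<le> M"
  shows "\<exists>L. L-lipschitz_on V g"
proof -
  obtain s S where s: "s > 0" "\<And>c u v. u \<in> V \<inter> cball c s \<Longrightarrow> v \<in> V \<inter> cball c s \<Longrightarrow> u = v"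
    and S: "S > 0" "\<And>c. V \<inter> cball c S \<noteq> {}"
    using assms(1) unfolding delone_def by metis
  have sep: "s < dist u v" if "u \<in> V" "v \<in> V" "u \<noteq> v" for u v
    using s(2)[of u u v] s(1) that by force
  \<comment> \<open>The summand 1 turns the strict bound of \<open>bounded_steps\<close> into the
    non-strict one used by the chain.\<close>
  obtain M where M: "\<And>u v. u \<in> V \<Longrightarrow> v \<in> V \<Longrightarrow> dist u v < 2 * S + s + 1 \<Longrightarrow> dist (g u) (g v) \<le> M"
    using bounded_steps[of "2 * S + s + 1"] s(1) S(1) by fastforce
  obtain p where "p \<in> V"
    using S(2) by blast
  then have "M \<ge> 0"
    using M[of p p] s(1) S(1) by simp
  \<comment> \<open>The factor 3: with q = \<open>dist u v / s\<close> \<ge> 1, the number of jumps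
    is at most q + 2 \<le> 3q.\<close>
  have "dist (g u) (g v) \<le> 3 * M / s * dist u v" if uv: "u \<in> V" "v \<in> V" for u v
  proof (cases "u = v")
    case False
    define n where "n = nat \<lceil>dist u v / s\<rceil>"
    have n: "dist u v / s \<le> real n" "real n \<le> dist u v / s + 1"
      using s(1) by (auto simp: n_def of_nat_nat zero_le_divide_iff)
    have "1 \<le> dist u v / s"
      using sep[OF uv False] s(1) by simp
    with n(2) have n3: "real n + 1 \<le> 3 * (dist u v / s)"
      by linarith
    have "dist (g u) (g v) \<le> (real n + 1) * M"
    \<comment> \<open>The walk starts at \<open>c = u\<close>, and the separation constant
      \<open>s\<close> doubles as its step length.\<close>
    proof (rule relatively_dense_chain_bound[of V S s g M u v u n])
      show "dist u v \<le> real n * s"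
        using n(1) s(1) by (simp add: field_simps)
    qed (use S s(1) M uv in auto)
    also have "\<dots> \<le> 3 * (dist u v / s) * M"
      using n3 \<open>M \<ge> 0\<close> by (rule mult_right_mono)
    finally show ?thesis
      by (simp add: mult_ac)
  qed simp
  then have "(3 * M / s)-lipschitz_on V g"
    using s(1) \<open>M \<ge> 0\<close> by (intro lipschitz_onI) auto
  then show ?thesis ..
qed

text \<open>The value \<open>\<omega> r\<close> is itself the bound for \<open>inv_into U f\<close>
  at scale \<open>r\<close>.\<close>

lemma co_uniformly_continuous_imp_lipschitz_on_inv:
  fixes f :: "'a::metric_space \<Rightarrow> 'b::real_normed_vector"
  assumes "delone V" "bij_betw f U V" "co_uniformly_continuous U f"
  shows "\<exists>L. L-lipschitz_on V (inv_into U f)"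
proof (rule delone_lipschitz_on[OF assms(1)])
  obtain \<omega> where \<omega>: "co_uniformly_continuous_wrt \<omega> U f"
    using assms(3) unfolding co_uniformly_continuous_def by blast
  fix r :: real
  assume "r > 0"
  have "dist (inv_into U f u) (inv_into U f v) \<le> \<omega> r"
    if uv: "u \<in> V" "v \<in> V" "dist u v < r" for u v
  proof -
    have U: "inv_into U f u \<in> U" "inv_into U f v \<in> U"
      using bij_betw_inv_into[OF assms(2)] uv(1,2) by (auto dest: bij_betwE)
    have "inv_into U f v \<in> f -` ball (f (inv_into U f u)) r \<inter> U"
      using U uv assms(2) by (simp add: bij_betw_inv_into_right)
    then have "inv_into U f v \<in> ball (inv_into U f u) (\<omega> r)"
      using \<omega> U(1) \<open>r > 0\<close> unfolding co_uniformly_continuous_wrt_def by blast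
    then show ?thesis by simp
  qed
  then show "\<exists>M. \<forall>u\<in>V. \<forall>v\<in>V. dist u v < r \<longrightarrow> dist (inv_into U f u) (inv_into U f v) \<le> M"
    by blast
qed

lemma lipschitz_on_inv_imp_co_uniformly_continuous_linear:
  assumes "bij_betw f U V" "L-lipschitz_on V (inv_into U f)"
  shows "co_uniformly_continuous_linear U f"
proof -
  have L: "L \<ge> 0"
    using assms(2) by (rule lipschitz_on_nonneg)
  \<comment> \<open>The slope is \<open>L + 1\<close> because \<open>L\<close> may be 0, while a
    modulus must be positive and strictly increasing.\<close>
  have "modulus (\<lambda>r. (L + 1) * r)"
    using L by (auto simp: modulus_def strict_mono_on_def)
  moreover have "co_uniformly_continuous_wrt (\<lambda>r. (L + 1) * r) U f"
    unfolding co_uniformly_continuous_wrt_def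
  proof (intro ballI allI impI subsetI)
    fix x r y
    assume x: "x \<in> U" and "r > 0" and y: "y \<in> f -` ball (f x) r \<inter> U"
    have "f x \<in> V" "f y \<in> V"
      using assms(1) x y by (auto dest: bij_betwE)
    then have "dist x y \<le> L * dist (f x) (f y)"
      using lipschitz_onD[OF assms(2), of "f x" "f y"] assms(1) x y
      by (simp add: bij_betw_inv_into_left)
    also have "\<dots> \<le> (L + 1) * dist (f x) (f y)"
      by (simp add: mult_right_mono)
    also have "\<dots> < (L + 1) * r"
      using y L by simp
    finally show "y \<in> ball x ((L + 1) * r)" by simp
  qed
  moreover have "\<exists>C>0. \<forall>r>0. (L + 1) * r \<le> C * r"
    using L by (intro exI[of _ "L + 1"]) auto
  ultimately show ?thesis
    unfolding co_uniformly_continuous_linear_def by blast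
qed

theorem corollary2p3:
  fixes U V :: "(real ^ 'n) set" and f :: "real ^ 'n \<Rightarrow> real ^ 'n"
  assumes "ediameter U = \<infinity>"
    and "delone V"
    and "bij_betw f U V"
  shows "(co_uniformly_continuous U f \<longleftrightarrow> co_uniformly_continuous_linear U f) \<and>
         (co_uniformly_continuous_linear U f \<longleftrightarrow> (\<exists>L. L-lipschitz_on V (inv_into U f)))"
proof -
  \<comment> \<open>This closes the cycle (i) to (iii) to (ii) to (i).\<close>
  have "co_uniformly_continuous U f" if "co_uniformly_continuous_linear U f"
    using that unfolding co_uniformly_continuous_linear_def co_uniformly_continuous_def by blast
  then show ?thesis
    using co_uniformly_continuous_imp_lipschitz_on_inv[OF assms(2,3)]
      lipschitz_on_inv_imp_co_uniformly_continuous_linear[OF assms(3)] by blast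
qed

end
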